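(* Let $n \geq 3$ and $1 \leq k \leq n-1$ be integers, let $\eta_0,\dots,\eta_{n-1}$ be real numbers with $\eta_j \geq 0$ for $j=0,\dots,n-1$ and $\eta_0\eta_k \neq 0$, and suppose that the polynomial $$\phi(x)=x^{n} + \eta_{n-1} x^{n-1} + \dots + \eta_{k+1} x^{k+1} - \eta_k x^{k} + \eta_{k-1} x^{k-1} + \dots + \eta_0$$ has two positive roots $r$ and $R$ with $r<R$. Let $$\phi_1(x) = x^{n} + \eta_{n-1} x^{n-1} + \dots + \eta_{k+1} x^{k+1}, \qquad \phi_2(x) = -\eta_k x^{k} + \eta_{k-1} x^{k-1} + \dots + \eta_1 x + \eta_0 .$$ Then for every $\bar{x}$ with $r\leq \bar{x}\leq R$, the trinomial $$f(x)=\alpha x^{n} - \beta x^{k} + \gamma ,$$ where $$\alpha = \frac{1}{n}\,\bar{x}^{\,1-n}\phi_1'(\bar{x}), \qquad \beta = -\frac{1}{k}\,\bar{x}^{\,1-k}\phi_2'(\bar{x}), \qquad \gamma = \phi(\bar{x}) - \bar{x}\left(\frac{1}{n}\phi_1'(\bar{x}) + \frac{1}{k}\phi_2'(\bar{x})\right),$$ satisfies $\alpha>0$, $\beta>0$, $\gamma>0$, has two positive zeros $r_1$ and $r_2$ with $r\leq r_1<r_2\leq R$, and satisfies $f(x)\geq \phi(x)$ for all $x\geq 0$.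
   Context: With the convention $\eta_n=1$, $\phi_1(x)=\sum_{j=k+1}^{n}\eta_j x^j$, $\phi_2(x)=-\eta_k x^k+\sum_{j=0}^{k-1}\eta_j x^j$, and $\phi=\phi_1+\phi_2$. *)

theory Defs
  imports Complex_Main "HOL-Computational_Algebra.Polynomial"
begin

text \<open>
  The coefficients are given by a sequence \<open>\<eta>\<close> of which only \<open>\<eta> 0, \<dots>, \<eta> (n - 1)\<close> matter:
  the leading coefficient \<open>1\<close> is written out, so \<open>\<eta> n\<close> is never used.
\<close>

definition phi1 :: "nat \<Rightarrow> nat \<Rightarrow> (nat \<Rightarrow> real) \<Rightarrow> real poly" where
  "phi1 n k \<eta> = monom 1 n + (\<Sum>j\<in>{k+1..<n}. monom (\<eta> j) j)"

definition phi2 :: "nat \<Rightarrow> (nat \<Rightarrow> real) \<Rightarrow> real poly" where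
  "phi2 k \<eta> = - monom (\<eta> k) k + (\<Sum>j\<in>{0..<k}. monom (\<eta> j) j)"

definition phi :: "nat \<Rightarrow> nat \<Rightarrow> (nat \<Rightarrow> real) \<Rightarrow> real poly" where
  "phi n k \<eta> = phi1 n k \<eta> + phi2 k \<eta>"

end

theory Submission
  imports Defs
begin

text \<open>
  Put \<open>t = x / xbar\<close>. The trinomial arises from \<open>\<phi>\<close> by replacing each monomial \<open>t ^ j\<close> with
  \<open>(j / m) t ^ m + (1 - j / m)\<close>, where \<open>m = n\<close> in \<open>\<phi>\<^sub>1\<close> and \<open>m = k\<close> in \<open>\<phi>\<^sub>2\<close>; by weighted AM-GM
  this only increases the value for \<open>x \<ge> 0\<close>, and \<open>f\<close> touches \<open>\<phi>\<close> to first order at \<open>xbar\<close>.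
  Evaluating the same inequalities at \<open>x = 0\<close> gives the signs of \<open>\<beta>\<close> and \<open>\<gamma>\<close>.
  Moreover \<open>\<phi> x / x ^ k\<close> is strictly convex for \<open>x > 0\<close>, so \<open>\<phi>\<close> is negative strictly between its
  roots and crosses zero transversally at them. Hence \<open>f\<close> is negative somewhere in the open interval
  between \<open>r\<close> and \<open>R\<close>, whereas \<open>f \<ge> 0\<close> at \<open>r\<close> and \<open>R\<close>.
\<close>

section \<open>Inequalities between powers of a real number\<close>

text \<open>Telescoping: t^j - 1 is the sum of t^i (t - 1) over i < j, and t^i (t - 1) \<le> t^m (t
  - 1) because t^m - t^i and t - 1 never have opposite signs.\<close>

lemma power_minus_one_le:
  fixes t :: real
  assumes "0 \<le> t" "j \<le> m"
  shows "t ^ j - 1 \<le> real j * t ^ m * (t - 1)"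
  using assms(2)
proof (induction j)
  case (Suc j)
  have "0 \<le> (t ^ m - t ^ j) * (t - 1)"
  proof (cases "t \<ge> 1")
    case True
    then show ?thesis using Suc.prems by (intro mult_nonneg_nonneg) (auto intro: power_increasing)
  next
    case False
    then show ?thesis using Suc.prems assms(1)
      by (intro mult_nonpos_nonpos) (auto intro: power_decreasing)
  qed
  then show ?case using Suc by (simp add: algebra_simps)
qed simp

text \<open>Equality holds at m = j. Passing from m to m + 1 adds t^j on the left and j t^m (t - 1)
  + 1 on the right, which \<open>power_minus_one_le\<close> compares.\<close>

lemma weighted_AM_GM_power:
  fixes t :: real
  assumes "0 \<le> t" "j \<le> m"
  shows "real m * t ^ j \<le> real j * t ^ m + (real m - real j)"
  using assms(2)
proof (induction m rule: dec_induct)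
  case (step m)
  then show ?case using power_minus_one_le[OF assms(1), of j m] by (simp add: algebra_simps)
qed simp

text \<open>This is the tangent bound at 1 for the negative power t^(-m), cleared of denominators.
  The left side is 1 at m = 0 and does not increase with m; for t \<noteq> 1 each step is a strict
  decrease.\<close>

lemma power_tangent_aux:
  fixes t :: real
  assumes "0 < t"
  shows "t ^ m * (1 - real m * (t - 1)) \<le> 1"
    and "m > 0 \<Longrightarrow> t \<noteq> 1 \<Longrightarrow> t ^ m * (1 - real m * (t - 1)) < 1"
proof -
  have step: "t ^ m * (1 - real m * (t - 1)) - t ^ Suc m * (1 - real (Suc m) * (t - 1))
      = (real m + 1) * t ^ m * (t - 1)\<^sup>2" for m
    by (simp add: algebra_simps power2_eq_square)
  have le: "t ^ m * (1 - real m * (t - 1)) \<le> 1" for m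
  proof (induction m)
    case (Suc m)
    have "(real m + 1) * t ^ m * (t - 1)\<^sup>2 \<ge> 0" using assms by simp
    then show ?case using Suc step[of m] by linarith
  qed simp
  show "t ^ m * (1 - real m * (t - 1)) \<le> 1" by (rule le)
  assume "m > 0" "t \<noteq> 1"
  then obtain l where l: "m = Suc l" using gr0_implies_Suc by blast
  have "(real l + 1) * t ^ l * (t - 1)\<^sup>2 > 0"
    using assms \<open>t \<noteq> 1\<close> by (intro mult_pos_pos) auto
  then show "t ^ m * (1 - real m * (t - 1)) < 1"
    using le[of l] step[of l] unfolding l by linarith
qed

text \<open>The tangent inequality at \<open>1\<close> for the convex function \<open>t \<mapsto> t powi (j - k)\<close>.\<close>

lemma power_tangent:
  fixes t :: real
  assumes "0 < t"
  shows "t ^ k * (1 + (real j - real k) * (t - 1)) \<le> t ^ j"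
proof (cases "j \<le> k")
  case True
  define m where "m = k - j"
  have k: "k = j + m" using True m_def by simp
  have "t ^ k * (1 + (real j - real k) * (t - 1)) = t ^ j * (t ^ m * (1 - real m * (t - 1)))"
    by (simp add: k power_add algebra_simps)
  also have "\<dots> \<le> t ^ j * 1"
    by (intro mult_left_mono power_tangent_aux) (use assms in auto)
  finally show ?thesis by simp
next
  case False
  define m where "m = j - k"
  have j: "j = k + m" using False m_def by simp
  have "1 + real m * (t - 1) \<le> t ^ m"
    using Bernoulli_inequality[of "t - 1" m] assms by simp
  then show ?thesis using assms by (simp add: j power_add)
qed

section \<open>Termwise bounds for polynomials\<close>

lemma poly_eq_sum:
  fixes p :: "real poly"
  assumes "degree p \<le> m"
  shows "poly p x = (\<Sum>j\<le>m. coeff p j * x ^ j)"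
proof -
  have "poly p x = poly (\<Sum>j\<le>m. monom (coeff p j) j) x"
    using poly_as_sum_of_monoms'[OF assms] by simp
  then show ?thesis by (simp add: poly_sum poly_monom)
qed

lemma poly_pderiv_eq_sum:
  fixes p :: "real poly"
  assumes "degree p \<le> m"
  shows "x * poly (pderiv p) x = (\<Sum>j\<le>m. real j * (coeff p j * x ^ j))"
proof -
  have "pderiv p = pderiv (\<Sum>j\<le>m. monom (coeff p j) j)"
    using poly_as_sum_of_monoms'[OF assms] by simp
  also have "\<dots> = (\<Sum>j\<le>m. monom (real j * coeff p j) (j - 1))"
    by (simp add: higher_pderiv_sum[where n = 1, simplified] pderiv_monom)
  finally have "x * poly (pderiv p) x = (\<Sum>j\<le>m. x * (real j * coeff p j * x ^ (j - 1)))"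
    by (simp add: poly_sum poly_monom sum_distrib_left)
  \<comment> \<open>At j = 0 the truncated exponent \<open>j - 1\<close> is harmless, since the
    factor \<open>real j\<close> vanishes.\<close>
  also have "\<dots> = (\<Sum>j\<le>m. real j * (coeff p j * x ^ j))"
    by (intro sum.cong refl) (auto simp: power_eq_if)
  finally show ?thesis .
qed

text \<open>Weighted AM-GM is applied to each monomial in t = x / y. For j = m it is an equality, so
  the coefficient of degree m may be negative, as it is in \<open>phi2\<close>.\<close>

lemma poly_le_binomial:
  fixes p :: "real poly"
  assumes "degree p \<le> m" "m > 0" and nonneg: "\<And>j. j < m \<Longrightarrow> coeff p j \<ge> 0"
    and "0 < y" "0 \<le> x"
  shows "poly p x \<le> (x / y) ^ m * (y * poly (pderiv p) y / m) + (poly p y - y * poly (pderiv p) y / m)"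
proof -
  define t where "t = x / y"
  have t: "t \<ge> 0" "x = y * t" using assms by (auto simp: t_def)
  have "real m * poly p x = (\<Sum>j\<le>m. coeff p j * y ^ j * (real m * t ^ j))"
    by (simp add: poly_eq_sum[OF assms(1)] sum_distrib_left t(2) power_mult_distrib mult_ac)
  also have "\<dots> \<le> (\<Sum>j\<le>m. coeff p j * y ^ j * (real j * t ^ m + (real m - real j)))"
  proof (intro sum_mono)
    fix j assume "j \<in> {..m}"
    then consider "j = m" | "j < m" by fastforce
    then show "coeff p j * y ^ j * (real m * t ^ j)
        \<le> coeff p j * y ^ j * (real j * t ^ m + (real m - real j))"
    proof cases
      case 2
      then show ?thesis using nonneg[OF 2] assms(4) t
        by (intro mult_left_mono weighted_AM_GM_power) auto
    qed simp
  qed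
  also have "\<dots> = t ^ m * (y * poly (pderiv p) y) + (m * poly p y - y * poly (pderiv p) y)"
    unfolding poly_eq_sum[OF assms(1)] poly_pderiv_eq_sum[OF assms(1)]
    by (simp add: sum_distrib_left sum.distrib sum_subtractf algebra_simps)
  also have "\<dots> = m * (t ^ m * (y * poly (pderiv p) y / m) + (poly p y - y * poly (pderiv p) y / m))"
    using assms(2) by (simp add: field_simps)
  finally show ?thesis using assms(2) by (simp add: t_def)
qed

text \<open>
  Strict convexity of \<open>x \<mapsto> poly p x / x ^ k\<close> on the positive half-line, as a tangent inequality.
\<close>

lemma poly_gt_tangent:
  fixes p :: "real poly"
  assumes "k > 0" and nonneg: "\<And>j. j \<noteq> k \<Longrightarrow> coeff p j \<ge> 0" and "coeff p 0 > 0"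
    and "0 < y" "0 < x" "x \<noteq> y"
  shows "(x / y) ^ k * (poly p y + (x / y - 1) * (y * poly (pderiv p) y - k * poly p y)) < poly p x"
proof -
  define t where "t = x / y"
  define m where "m = degree p"
  have m: "degree p \<le> m" by (simp add: m_def)
  have t: "t > 0" "t \<noteq> 1" "x = y * t" using assms by (auto simp: t_def)
  \<comment> \<open>The bracket is y^k times the tangent at t = 1 of p(y t) / (y t)^k; termwise,
    t^(j - k) has slope j - k there.\<close>
  have "t ^ k * (poly p y + (t - 1) * (y * poly (pderiv p) y - k * poly p y))
      = (\<Sum>j\<le>m. coeff p j * y ^ j * (t ^ k * (1 + (real j - real k) * (t - 1))))"
    unfolding poly_eq_sum[OF m] poly_pderiv_eq_sum[OF m]
    by (simp add: sum_distrib_left sum.distrib sum_subtractf algebra_simps)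
  also have "\<dots> < (\<Sum>j\<le>m. coeff p j * y ^ j * t ^ j)"
  proof (rule sum_strict_mono_ex1)
    show "\<forall>j\<in>{..m}. coeff p j * y ^ j * (t ^ k * (1 + (real j - real k) * (t - 1)))
        \<le> coeff p j * y ^ j * t ^ j"
    proof
      fix j
      show "coeff p j * y ^ j * (t ^ k * (1 + (real j - real k) * (t - 1)))
        \<le> coeff p j * y ^ j * t ^ j"
      proof (cases "j = k")
        case False
        then show ?thesis using nonneg[of j] assms(4) power_tangent[OF t(1)]
          by (intro mult_left_mono) auto
      qed simp
    qed
    \<comment> \<open>Strictness comes from the constant term, whose exponent -k is
      negative.\<close>
    have "coeff p 0 * (t ^ k * (1 - real k * (t - 1))) < coeff p 0 * 1"
      using power_tangent_aux(2)[OF t(1) assms(1) t(2)] assms(3) by (intro mult_strict_left_mono)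
    then show "\<exists>j\<in>{..m}. coeff p j * y ^ j * (t ^ k * (1 + (real j - real k) * (t - 1)))
        < coeff p j * y ^ j * t ^ j"
      by (intro bexI[of _ 0]) auto
  qed simp
  also have "\<dots> = poly p x"
    by (simp add: poly_eq_sum[OF m] t(3) power_mult_distrib mult_ac)
  finally show ?thesis by (simp add: t_def)
qed

section \<open>Coefficients, and the signs of \<alpha> and \<gamma>\<close>

lemma coeff_phi1:
  assumes "k < n"
  shows "coeff (phi1 n k \<eta>) j = (if j = n then 1 else if k < j \<and> j < n then \<eta> j else 0)"
  using assms by (auto simp: phi1_def coeff_sum coeff_monom)

lemma coeff_phi2:
  "coeff (phi2 k \<eta>) j = (if j = k then - \<eta> k else if j < k then \<eta> j else 0)"
  by (auto simp: phi2_def coeff_sum coeff_monom)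

lemma power_quotient_eq_powi:
  fixes x y :: real
  assumes "y \<noteq> 0"
  shows "(x / y) ^ m * (y * d / m) = (1 / real m * y powi (1 - int m) * d) * x ^ m"
  using assms by (simp add: power_int_diff power_divide mult_ac)

theorem theorem3p1:
  fixes n k :: nat and \<eta> :: "nat \<Rightarrow> real" and r R xbar \<alpha> \<beta> \<gamma> :: real and f :: "real poly"
  assumes "n \<ge> 3" and "1 \<le> k" and "k \<le> n - 1"
    and "\<And>j. j \<le> n - 1 \<Longrightarrow> \<eta> j \<ge> 0"
    and "\<eta> 0 * \<eta> k \<noteq> 0"
    and "0 < r" and "r < R"
    and "poly (phi n k \<eta>) r = 0" and "poly (phi n k \<eta>) R = 0"
    and "r \<le> xbar" and "xbar \<le> R"
    and "\<alpha> = 1 / real n * xbar powi (1 - int n) * poly (pderiv (phi1 n k \<eta>)) xbar"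
    and "\<beta> = - (1 / real k) * xbar powi (1 - int k) * poly (pderiv (phi2 k \<eta>)) xbar"
    and "\<gamma> = poly (phi n k \<eta>) xbar
           - xbar * (1 / real n * poly (pderiv (phi1 n k \<eta>)) xbar
                     + 1 / real k * poly (pderiv (phi2 k \<eta>)) xbar)"
    and "f = monom \<alpha> n - monom \<beta> k + [:\<gamma>:]"
  shows "\<alpha> > 0 \<and> \<beta> > 0 \<and> \<gamma> > 0
    \<and> (\<exists>r1 r2. 0 < r1 \<and> 0 < r2 \<and> poly f r1 = 0 \<and> poly f r2 = 0
              \<and> r \<le> r1 \<and> r1 < r2 \<and> r2 \<le> R)
    \<and> (\<forall>x\<ge>0. poly f x \<ge> poly (phi n k \<eta>) x)"
proof -
  let ?p1 = "phi1 n k \<eta>" and ?p2 = "phi2 k \<eta>" and ?p = "phi n k \<eta>"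
  have kn: "k < n" and k0: "k > 0" and n0: "n > 0" using assms(1-3) by auto
  have y: "xbar > 0" using assms by simp
  have eta0: "\<eta> 0 > 0" using assms(4)[of 0] assms(5) by (auto simp: less_le)
  have eta: "\<eta> j \<ge> 0" if "j < n" for j using assms(4)[of j] that by auto
  have deg1: "degree ?p1 \<le> n" by (rule degree_le) (auto simp: coeff_phi1[OF kn])
  have deg2: "degree ?p2 \<le> k" by (rule degree_le) (auto simp: coeff_phi2)
  have nonneg1: "coeff ?p1 j \<ge> 0" for j using eta by (auto simp: coeff_phi1[OF kn])
  have nonneg2: "coeff ?p2 j \<ge> 0" if "j \<noteq> k" for j
    using eta kn that by (auto simp: coeff_phi2)
  have p_eq: "poly ?p x = poly ?p1 x + poly ?p2 x"
    and dp_eq: "poly (pderiv ?p) x = poly (pderiv ?p1) x + poly (pderiv ?p2) x" for x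
    by (auto simp: phi_def pderiv_add)
  have nonneg: "coeff ?p j \<ge> 0" if "j \<noteq> k" for j
    using nonneg1 nonneg2[OF that] by (simp add: phi_def)
  have c0: "coeff ?p1 0 = 0" "coeff ?p2 0 = \<eta> 0" "coeff ?p 0 = \<eta> 0"
    using k0 kn by (auto simp: phi_def coeff_phi1 coeff_phi2)
  \<comment> \<open>In the variable x / xbar the coefficients of \<open>f\<close> are d1 / n and d2
    / k, exactly those of the AM-GM bounds.\<close>
  define d1 where "d1 = xbar * poly (pderiv ?p1) xbar"
  define d2 where "d2 = xbar * poly (pderiv ?p2) xbar"
  have bound1: "poly ?p1 x \<le> (x / xbar) ^ n * (d1 / n) + (poly ?p1 xbar - d1 / n)" if "x \<ge> 0" for x
    using poly_le_binomial[OF deg1 n0 nonneg1 y that] by (simp add: d1_def)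
  have bound2: "poly ?p2 x \<le> (x / xbar) ^ k * (d2 / k) + (poly ?p2 xbar - d2 / k)" if "x \<ge> 0" for x
    using poly_le_binomial[OF deg2 k0 nonneg2 y that] by (simp add: d2_def)
  have f_eq: "poly f x = (x / xbar) ^ n * (d1 / n) + (x / xbar) ^ k * (d2 / k) + \<gamma>" for x
    unfolding d1_def d2_def power_quotient_eq_powi[OF y[THEN less_imp_neq, symmetric]]
    by (simp add: assms(12,13,15) poly_monom)
  have gamma_eq: "\<gamma> = (poly ?p1 xbar - d1 / n) + (poly ?p2 xbar - d2 / k)"
    by (simp add: assms(14) d1_def d2_def p_eq algebra_simps)
  have f_ge: "poly f x \<ge> poly ?p x" if "x \<ge> 0" for x
    using bound1[OF that] bound2[OF that] by (simp add: f_eq gamma_eq p_eq)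
  have f_y: "poly f xbar = poly ?p xbar"
    using y by (simp add: f_eq gamma_eq p_eq)
  \<comment> \<open>At x = 0 the two bounds compare with the constant terms 0 and
    \<open>\<eta> 0\<close>; together they give \<gamma> \<ge> \<open>\<eta> 0\<close>.\<close>
  have at0: "d1 / n \<le> poly ?p1 xbar" "\<eta> 0 \<le> poly ?p2 xbar - d2 / k"
    using bound1[of 0] bound2[of 0] c0 k0 n0 by (auto simp: poly_0_coeff_0 power_0_left)
  have d1: "d1 > 0"
    unfolding d1_def poly_pderiv_eq_sum[OF deg1]
  proof (rule sum_pos2[where i = n])
    show "0 < real n * (coeff ?p1 n * xbar ^ n)" using n0 y by (simp add: coeff_phi1[OF kn])
  qed (use nonneg1 y in auto)
  have p1_pos: "poly ?p1 xbar > 0" using at0(1) d1 n0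
    by (meson divide_pos_pos of_nat_0_less_iff less_le_trans)
  have alpha: "\<alpha> > 0"
  proof -
    have "poly (pderiv ?p1) xbar > 0" using d1 y by (simp add: d1_def zero_less_mult_iff)
    then show ?thesis using y n0 by (simp add: assms(12))
  qed
  have gamma: "\<gamma> > 0" using at0 eta0 by (simp add: gamma_eq)

  \<comment> \<open>A point between the roots where \<open>f\<close> is negative\<close>
  define D where "D = d1 + d2 - k * poly ?p xbar"
  \<comment> \<open>\<open>D\<close> is the slope at t = 1 of t^(-k) \<phi>(xbar t). By strict
    convexity the tangent at xbar lies strictly below zero at every other positive root.\<close>
  have tangent: "poly ?p xbar + (x / xbar - 1) * D < 0"
    if "x > 0" "x \<noteq> xbar" "poly ?p x = 0" for x
  proof -
    have "(x / xbar) ^ k * (poly ?p xbar + (x / xbar - 1) * D) < 0"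
      using poly_gt_tangent[OF k0 nonneg _ y that(1,2)] that(3) c0 eta0
      by (simp add: D_def d1_def d2_def dp_eq distrib_left)
    moreover have "(x / xbar) ^ k > 0" using that(1) y by simp
    ultimately show ?thesis by (meson mult_less_0_iff less_asym)
  qed
  have tangent_r: "poly ?p xbar + (r / xbar - 1) * D < 0" if "r \<noteq> xbar"
    using tangent[OF assms(6) that assms(8)] .
  have tangent_R: "poly ?p xbar + (R / xbar - 1) * D < 0" if "R \<noteq> xbar"
    using tangent[OF _ that assms(9)] assms(6,7) by simp
  have deriv: "(poly f has_real_derivative poly (pderiv f) x) (at x)" for x
    by (rule poly_DERIV)
  have deriv_y: "xbar * poly (pderiv f) xbar = d1 + d2"
  proof -
    have "((\<lambda>x. (x / xbar) ^ n * (d1 / n) + (x / xbar) ^ k * (d2 / k) + \<gamma>)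
        has_real_derivative (d1 + d2) / xbar) (at xbar)"
      using y k0 n0 by (auto intro!: derivative_eq_intros simp: add_divide_distrib)
    then have "(poly f has_real_derivative (d1 + d2) / xbar) (at xbar)"
      unfolding f_eq[symmetric] .
    then have "poly (pderiv f) xbar = (d1 + d2) / xbar"
      using deriv DERIV_unique by blast
    then show ?thesis using y by simp
  qed
  have "poly ?p xbar \<le> 0 \<and> (\<exists>z. r < z \<and> z < R \<and> poly f z < 0)"
  proof -
    consider "xbar = r" | "xbar = R" | "r < xbar" "xbar < R" using assms(10,11) by linarith
    then show ?thesis
    proof cases
      case 1
      \<comment> \<open>Here the tangent passes through zero at xbar and is negative at
        \<open>R\<close>, so \<open>D\<close> < 0. As \<phi>(xbar) = 0, \<open>D\<close> is also
        xbar times the derivative of \<open>f\<close>, so \<open>f\<close> falls below zero just to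
        the right of \<open>r\<close>.\<close>
      have p0: "poly ?p xbar = 0" using 1 assms(8) by simp
      have "(R / xbar - 1) * D < 0" using tangent_R 1 assms(7) p0 by simp
      moreover have "R / xbar - 1 > 0" using 1 assms(7) y by simp
      ultimately have "D < 0" by (simp add: mult_less_0_iff)
      then have "xbar * poly (pderiv f) xbar < 0" using p0 by (simp add: D_def deriv_y)
      then have "poly (pderiv f) xbar < 0" using y by (simp add: mult_less_0_iff)
      then obtain e where e: "e > 0" "\<And>h. h > 0 \<Longrightarrow> h < e \<Longrightarrow> poly f (xbar + h) < poly f xbar"
        using DERIV_neg_dec_right[OF deriv] by blast
      define h where "h = min (e / 2) ((R - r) / 2)"
      have h: "h > 0" "h < e" "h < R - r" using e(1) assms(7) by (auto simp: h_def min_def)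
      have "poly f (xbar + h) < 0" using e(2)[OF h(1,2)] f_y p0 by simp
      then show ?thesis using p0 h 1 by (intro conjI exI[of _ "xbar + h"]) auto
    next
      case 2
      have p0: "poly ?p xbar = 0" using 2 assms(9) by simp
      have "(r / xbar - 1) * D < 0" using tangent_r 2 assms(7) p0 by simp
      moreover have "r / xbar - 1 < 0" using 2 assms(7) y by simp
      ultimately have "D > 0" by (simp add: mult_less_0_iff)
      then have "xbar * poly (pderiv f) xbar > 0" using p0 by (simp add: D_def deriv_y)
      then have "poly (pderiv f) xbar > 0" using y by (simp add: zero_less_mult_iff)
      then obtain e where e: "e > 0" "\<And>h. h > 0 \<Longrightarrow> h < e \<Longrightarrow> poly f (xbar - h) < poly f xbar"
        using DERIV_pos_inc_left[OF deriv] by blast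
      \<comment> \<open>Half the interval length keeps the witness xbar - h strictly to the right of
        \<open>r\<close>.\<close>
      define h where "h = min (e / 2) ((R - r) / 2)"
      have h: "h > 0" "h < e" "h < R - r" using e(1) assms(7) by (auto simp: h_def min_def)
      have "poly f (xbar - h) < 0" using e(2)[OF h(1,2)] f_y p0 by simp
      then show ?thesis using p0 h 2 by (intro conjI exI[of _ "xbar - h"]) auto
    next
      case 3
      have neg: "r / xbar - 1 < 0" "R / xbar - 1 > 0" using 3 y by auto
      \<comment> \<open>The roots lie on opposite sides of xbar, so at one of them the tangent is at
        least \<phi>(xbar); being negative there, it forces \<phi>(xbar) < 0, and z = xbar
        serves.\<close>
      have "(r / xbar - 1) * D \<ge> 0 \<or> (R / xbar - 1) * D \<ge> 0"
        using neg by (cases "D \<ge> 0") (auto simp: zero_le_mult_iff)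
      then have "poly ?p xbar < 0" using tangent_r tangent_R 3 by auto
      then show ?thesis using f_y 3 by auto
    qed
  qed
  then obtain z where p_y: "poly ?p xbar \<le> 0" and z: "r < z" "z < R" "poly f z < 0" by blast

  \<comment> \<open>The sign of \<beta> and the zeros of \<open>f\<close>\<close>
  have beta: "\<beta> > 0"
  proof -
    \<comment> \<open>The bound at zero gives d2 / k \<le> \<phi>(xbar) - \<phi>_1(xbar) -
      \<open>\<eta> 0\<close>, where \<phi>(xbar) \<le> 0 and the other two terms are
      negative.\<close>
    have "d2 / k < 0" using at0(2) eta0 p_y p1_pos by (simp add: p_eq)
    then have "poly (pderiv ?p2) xbar < 0"
      using y k0 by (simp add: d2_def divide_less_0_iff mult_less_0_iff)
    then show ?thesis using y k0 by (simp add: assms(13) mult_less_0_iff divide_less_0_iff)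
  qed
  have fr: "poly f r \<ge> 0" "poly f R \<ge> 0"
    using f_ge[of r] f_ge[of R] assms(6-9) by auto
  obtain r1 where r1: "r \<le> r1" "r1 \<le> z" "poly f r1 = 0"
    using IVT2'[of "poly f" z 0 r] fr z by (force intro: continuous_intros)
  obtain r2 where r2: "z \<le> r2" "r2 \<le> R" "poly f r2 = 0"
    using IVT'[of "poly f" z 0 R] fr z by (force intro: continuous_intros)
  \<comment> \<open>The zeros lie on either side of \<open>z\<close>, which is itself not a
    zero.\<close>
  have "r1 < r2" using r1 r2 z(3) by (cases "r1 = z") auto
  then show ?thesis
    using alpha beta gamma f_ge r1 r2 assms(6) by (intro conjI exI[of _ r1] exI[of _ r2]) auto
qed

end
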